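(* Let $\lambda>0$, $k>0$, $B>0$ and $C<B$ be fixed constants. For $0<\alpha<1$ let $\tilde\xi_\alpha>0$ be the unique positive solution of $$\xi\left[1-W\left(-\xi,-\tfrac{\alpha}{2},1\right)\right]\frac{1}{M_{\alpha/2}(\xi)}=\frac{k}{\lambda^2}\,\frac{\Gamma(1-\frac{\alpha}{2})}{\Gamma(1+\frac{\alpha}{2})}\,(B-C),$$ and let $$u_{1,\alpha}(x,t)=B+\frac{C-B}{1-W\left(-\tilde\xi_\alpha,-\frac{\alpha}{2},1\right)}\left[1-W\left(-\frac{x}{\lambda t^{\alpha/2}},-\frac{\alpha}{2},1\right)\right],\qquad s_{1,\alpha}(t)=\lambda\tilde\xi_\alpha\,t^{\alpha/2}.$$ Then for all $x\ge0$ and $t>0$, $$\lim_{\alpha\nearrow1}u_{1,\alpha}(x,t)=B+\frac{C-B}{\operatorname{erf}(\tilde\xi/2)}\,\operatorname{erf}\left(\frac{x}{2\lambda\sqrt t}\right),\qquad \lim_{\alpha\nearrow1}s_{1,\alpha}(t)=\lambda\tilde\xi\sqrt t,$$ where $\tilde\xi>0$ is the unique positive solution of $$\frac{\xi}{2}\operatorname{erf}\left(\frac{\xi}{2}\right)e^{\xi^2/4}=\frac{k}{\lambda^2}\,\frac{B-C}{\sqrt\pi}.$$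
   Context: The Wright function is $W(z,a,b)=\sum_{n=0}^{\infty}\frac{z^n}{n!\,\Gamma(an+b)}$ (entire in $z$ for real $a>-1$), with $1/\Gamma=0$ at the poles of $\Gamma$. The Mainardi function is $M_\nu(z)=W(-z,-\nu,1-\nu)$. The error function is $\operatorname{erf}(x)=\frac{2}{\sqrt\pi}\int_0^xe^{-y^2}\,dy$. The pair $\{u_{1,\alpha},s_{1,\alpha}\}$ is the explicit similarity solution of the one-phase Stefan problem for the time-fractional diffusion equation of order $\alpha$ (Caputo) with $u(0,t)=B$, $u(s(t),t)=C$, $D^\alpha s(t)=-k\,u_x(s(t),t)$, $s(0)=0$. The equation defining $\tilde\xi_\alpha$ does have a unique positive solution for each $\alpha\in(0,1)$. *)

theory Defs
  imports "HOL-Analysis.Analysis"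
begin

(* rGamma is the entire reciprocal Gamma function, so that terms with a * n + b a pole of
   Gamma vanish. The series converges for every z when a > -1. *)
definition wright :: "'a::{real_normed_field,banach} \<Rightarrow> real \<Rightarrow> real \<Rightarrow> 'a" where
  "wright z a b = (\<Sum>n. z ^ n / fact n * of_real (rGamma (a * real n + b)))"

definition mainardi :: "real \<Rightarrow> 'a::{real_normed_field,banach} \<Rightarrow> 'a" where
  "mainardi \<nu> z = wright (- z) (- \<nu>) (1 - \<nu>)"

(* The interval integral is oriented, so this is the odd function erf also for x < 0. *)
definition erf :: "real \<Rightarrow> real" where
  "erf x = 2 / sqrt pi * (LBINT y=0..x. exp (- (y\<^sup>2)))"

definition unique_pos_solution :: "(real \<Rightarrow> bool) \<Rightarrow> real \<Rightarrow> bool" where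
  "unique_pos_solution P \<xi> \<longleftrightarrow> \<xi> > 0 \<and> P \<xi> \<and> (\<forall>\<eta>>0. P \<eta> \<longrightarrow> \<eta> = \<xi>)"

definition frac_stefan_eq :: "real \<Rightarrow> real \<Rightarrow> real \<Rightarrow> real \<Rightarrow> real \<Rightarrow> real \<Rightarrow> bool" where
  "frac_stefan_eq l k B C \<alpha> \<xi> \<longleftrightarrow>
     \<xi> * (1 - wright (- \<xi>) (- (\<alpha> / 2)) 1) * (1 / mainardi (\<alpha> / 2) \<xi>)
       = k / l\<^sup>2 * (Gamma (1 - \<alpha> / 2) / Gamma (1 + \<alpha> / 2)) * (B - C)"

definition stefan_eq :: "real \<Rightarrow> real \<Rightarrow> real \<Rightarrow> real \<Rightarrow> real \<Rightarrow> bool" where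
  "stefan_eq l k B C \<xi> \<longleftrightarrow>
     \<xi> / 2 * erf (\<xi> / 2) * exp (\<xi>\<^sup>2 / 4) = k / l\<^sup>2 * ((B - C) / sqrt pi)"

(* In the next two definitions \<xi> is the value of the similarity coefficient at order \<alpha>. *)
definition frac_stefan_u ::
    "real \<Rightarrow> real \<Rightarrow> real \<Rightarrow> real \<Rightarrow> real \<Rightarrow> real \<Rightarrow> real \<Rightarrow> real" where
  "frac_stefan_u l B C \<alpha> \<xi> x t =
     B + (C - B) / (1 - wright (- \<xi>) (- (\<alpha> / 2)) 1)
       * (1 - wright (- (x / (l * t powr (\<alpha> / 2)))) (- (\<alpha> / 2)) 1)"

definition frac_stefan_s :: "real \<Rightarrow> real \<Rightarrow> real \<Rightarrow> real \<Rightarrow> real" where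
  "frac_stefan_s l \<alpha> \<xi> t = l * \<xi> * t powr (\<alpha> / 2)"

end

theory Submission
  imports Defs
begin

text \<open>
  Two facts carry the limit \<open>\<alpha> \<nearrow> 1\<close>. First, the Wright series is dominated by one summable
  sequence as long as \<open>z\<close> is bounded, \<open>a \<in> [-1/2, -1/4]\<close> and \<open>b \<in> [1/2, 1]\<close>, so that \<open>W(z, a, b)\<close>
  is jointly continuous up to \<open>a = -1/2\<close> (\<open>continuous_on_wright\<close>). By the reflection formula
  \<open>\<bar>1 / \<Gamma>(b + a n)\<bar>\<close> is at most \<open>\<Gamma>(1 - b - a n)\<close>, which grows no faster than \<open>\<Gamma>((n + 1) / 2)\<close> and is
  therefore beaten by \<open>n!\<close>. Second, at the end point the functions are classical:
  \<open>M\<^sub>1\<^sub>/\<^sub>2\<close> is a Gaussian (\<open>mainardi_half\<close>), and since \<open>W(-x, -1/2, 1)\<close> has derivative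
  \<open>- M\<^sub>1\<^sub>/\<^sub>2(x)\<close>, it equals \<open>1 - erf (x / 2)\<close> (\<open>wright_half\<close>).

  Hence the equation for \<open>\<xi> \<alpha>\<close> converges pointwise to the classical one, whose left-hand side
  increases strictly from \<open>0\<close> to infinity and so has a single positive root \<open>\<xi>1\<close>. On a small
  interval around \<open>\<xi>1\<close> the limit equation changes sign from negative to positive, hence so does the
  equation of order \<open>\<alpha>\<close> for \<open>\<alpha>\<close> near 1; the intermediate value theorem gives it a root there, which
  by the assumed uniqueness is \<open>\<xi> \<alpha>\<close> (\<open>tendsto_unique_root\<close>).
  Joint continuity of \<open>W\<close> then gives the limits of \<open>u\<close> and \<open>s\<close>.
\<close>

section \<open>Bounds for the Gamma function\<close>

lemma rGamma_reflection_real: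
  fixes x :: real
  shows "rGamma x * rGamma (1 - x) = sin (pi * x) / pi"
proof -
  have "complex_of_real (rGamma x * rGamma (1 - x)) = of_real (sin (pi * x) / pi)"
    using rGamma_reflection_complex[of "of_real x"] rGamma_complex_of_real[of "1 - x"]
    by (simp add: rGamma_complex_of_real sin_of_real[symmetric])
  then show ?thesis
    by (simp only: of_real_eq_iff)
qed

lemma abs_rGamma_le:
  fixes x :: real
  assumes "x < 1"
  shows "\<bar>rGamma x\<bar> \<le> Gamma (1 - x)"
proof -
  have pos: "Gamma (1 - x) > 0"
    using assms by simp
  have "rGamma x = sin (pi * x) / pi * Gamma (1 - x)"
    using rGamma_reflection_real[of x] pos
    by (simp add: rGamma_inverse_Gamma[of "1 - x"] field_simps)
  also have "\<bar>\<dots>\<bar> = \<bar>sin (pi * x)\<bar> / pi * Gamma (1 - x)"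
    using pos by (simp add: abs_mult)
  also have "\<dots> \<le> 1 * Gamma (1 - x)"
  proof (rule mult_right_mono)
    have "\<bar>sin (pi * x)\<bar> \<le> pi"
      by (rule order_trans[OF abs_sin_le_one]) (use pi_ge_two in linarith)
    then show "\<bar>sin (pi * x)\<bar> / pi \<le> 1"
      by simp
  qed (use pos in simp)
  finally show ?thesis by simp
qed

text \<open>\<open>\<Gamma>\<close> is log-convex, so on an interval it is at most the larger of its end-point values; the sum
  of the two is more convenient in a series than the maximum.\<close>

lemma Gamma_le_sum_endpoints:
  fixes x y z :: real
  assumes "0 < x" "x \<le> y" "y \<le> z"
  shows "Gamma y \<le> Gamma x + Gamma z"
proof -
  have "convex_on {x..z} (ln \<circ> Gamma :: real \<Rightarrow> real)"
    using assms by (intro convex_on_subset[OF log_convex_Gamma_real]) auto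
  then have "ln (Gamma y) \<le> max (ln (Gamma x)) (ln (Gamma z))"
    using convex_on_le_max[of x z "ln \<circ> Gamma" y] assms by auto
  then have "Gamma y \<le> max (Gamma x) (Gamma z)"
    using assms by (auto simp: le_max_iff_disj)
  also have "\<dots> \<le> Gamma x + Gamma z"
    using assms Gamma_real_pos[of x] Gamma_real_pos[of z] by auto
  finally show ?thesis .
qed

text \<open>Log-convexity at the midpoint of \<open>x\<close> and \<open>x + 1\<close>, with \<open>\<Gamma>(x + 1) = x \<Gamma>(x)\<close>.\<close>

lemma Gamma_half_step:
  fixes x :: real
  assumes "x > 0"
  shows "Gamma (x + 1/2) \<le> sqrt x * Gamma x"
proof -
  have "(ln \<circ> Gamma) ((1 - 1/2) *\<^sub>R x + (1/2) *\<^sub>R (x + 1))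
      \<le> (1 - 1/2) * (ln \<circ> Gamma) x + (1/2) * (ln \<circ> Gamma) (x + 1)"
    using assms by (intro convex_onD[OF log_convex_Gamma_real]) auto
  also have "(1 - 1/2) *\<^sub>R x + (1/2) *\<^sub>R (x + 1) = x + 1/2"
    by (simp add: field_simps)
  also have "(1 - 1/2) * (ln \<circ> Gamma) x + (1/2) * (ln \<circ> Gamma) (x + 1)
      = ln (sqrt x * Gamma x)"
    using assms Gamma_plus1[of x] Gamma_real_pos[OF assms]
    by (auto simp: ln_mult ln_sqrt field_simps nonpos_Ints_def)
  finally show ?thesis
    using assms Gamma_real_pos[OF assms] Gamma_real_pos[of "x + 1/2"] by simp
qed

text \<open>The ratio of consecutive terms is at most \<open>R \<surd>x / (2 x)\<close> with \<open>x = (n + 1) / 2\<close>, by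
  the lemma above.\<close>

lemma summable_power_Gamma_half:
  fixes R :: real
  assumes "R \<ge> 0"
  shows "summable (\<lambda>n. R ^ n / fact n * Gamma ((real n + 1) / 2))"
proof -
  define N where "N = nat \<lceil>2 * R\<^sup>2\<rceil>"
  show ?thesis
  proof (rule summable_ratio_test[of "1/2" N])
    fix n assume "n \<ge> N"
    then have n: "2 * R\<^sup>2 \<le> real n + 1"
      unfolding N_def by linarith
    define x where "x = (real n + 1) / 2"
    have x: "x > 0" "real n + 1 = 2 * x" "(real (Suc n) + 1) / 2 = x + 1/2"
      by (auto simp: x_def field_simps)
    have G: "Gamma x > 0" using x by simp
    have "R \<le> sqrt x"
      using n x by (intro real_le_rsqrt) auto
    then have "R * sqrt x \<le> sqrt x * sqrt x"
      using x by (intro mult_right_mono) auto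
    then have Rx: "R * sqrt x \<le> x" using x by simp
    have "R ^ Suc n / fact (Suc n) * Gamma (x + 1/2)
        \<le> R ^ Suc n / fact (Suc n) * (sqrt x * Gamma x)"
      using assms Gamma_half_step[OF x(1)] by (intro mult_left_mono) auto
    also have "\<dots> = (R * sqrt x / (2 * x)) * (R ^ n / fact n * Gamma x)"
      using x by (simp add: field_simps)
    also have "\<dots> \<le> 1/2 * (R ^ n / fact n * Gamma x)"
      using Rx x G assms by (intro mult_right_mono) (auto simp: field_simps)
    finally show "norm (R ^ Suc n / fact (Suc n) * Gamma ((real (Suc n) + 1) / 2))
        \<le> 1/2 * norm (R ^ n / fact n * Gamma ((real n + 1) / 2))"
      unfolding x(3) using assms x G unfolding x_def[symmetric]
      by (simp add: abs_mult)
  qed simp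
qed

section \<open>Joint continuity of the Wright function\<close>

text \<open>For \<open>n \<ge> 1\<close>, \<open>a \<in> [-1/2, -1/4]\<close> and \<open>b \<in> [1/2, 1]\<close> the number \<open>1 - (a n + b)\<close> lies between
  \<open>1/4\<close> and \<open>(n + 1) / 2\<close>; these are the two arguments of \<open>\<Gamma>\<close> here.\<close>

definition wright_majorant :: "real \<Rightarrow> nat \<Rightarrow> real" where
  "wright_majorant R n = R ^ n / fact n * (Gamma (1/4) + Gamma ((real n + 1) / 2))"

lemma summable_wright_majorant:
  assumes "R \<ge> 0"
  shows "summable (wright_majorant R)"
proof -
  have "summable (\<lambda>n. R ^ n / fact n * Gamma (1/4))"
    using summable_exp[of R] by (intro summable_mult2) (simp add: field_simps)
  from summable_add[OF this summable_power_Gamma_half[OF assms]]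
  show ?thesis
    unfolding wright_majorant_def by (simp add: distrib_left)
qed

text \<open>The term \<open>n = 0\<close> has to be left out: there \<open>1 - b\<close> may be \<open>0\<close>, a pole of \<open>\<Gamma>\<close>.\<close>

lemma wright_term_le_majorant:
  fixes z :: real
  assumes "n > 0" "\<bar>z\<bar> \<le> R" "a \<in> {-1/2..-1/4}" "b \<in> {1/2..1}"
  shows "\<bar>z ^ n / fact n * rGamma (a * real n + b)\<bar> \<le> wright_majorant R n"
proof -
  have n1: "real n \<ge> 1" using assms by linarith
  have an: "a * real n \<le> - 1/4 * real n" "- 1/2 * real n \<le> a * real n"
    using assms by (intro mult_right_mono; simp)+
  then have lo: "1/4 \<le> 1 - (a * real n + b)" and hi: "1 - (a * real n + b) \<le> (real n + 1) / 2"
    using n1 assms by auto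
  have "\<bar>rGamma (a * real n + b)\<bar> \<le> Gamma (1 - (a * real n + b))"
    using lo by (intro abs_rGamma_le) linarith
  also have "\<dots> \<le> Gamma (1/4) + Gamma ((real n + 1) / 2)"
    using lo hi by (intro Gamma_le_sum_endpoints) auto
  finally have "\<bar>z\<bar> ^ n / fact n * \<bar>rGamma (a * real n + b)\<bar> \<le> wright_majorant R n"
    unfolding wright_majorant_def using assms
    by (intro mult_mono divide_right_mono power_mono) auto
  then show ?thesis
    by (simp add: abs_mult power_abs)
qed

lemma summable_wright:
  fixes z :: real
  assumes "a \<in> {-1/2..-1/4}" "b \<in> {1/2..1}"
  shows "summable (\<lambda>n. z ^ n / fact n * rGamma (a * real n + b))"
  using wright_term_le_majorant[OF _ order_refl assms]
  by (intro summable_comparison_test[OF _ summable_wright_majorant[of "\<bar>z\<bar>"]] exI[of _ 1]) auto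

text \<open>The parameters vary together with \<open>z\<close> because both \<open>\<xi> \<alpha>\<close> and the order \<open>\<alpha>\<close> move in the
  limit.\<close>

lemma continuous_on_wright:
  "continuous_on (UNIV \<times> {-1/2..-1/4} \<times> {1/2..1}) (\<lambda>(z::real, a, b). wright z a b)"
    (is "continuous_on (UNIV \<times> ?K) ?f")
proof -
  have loc: "continuous_on ({-R<..<R} \<times> ?K) ?f" if "R \<ge> 0" for R
  proof -
    define t where "t = (\<lambda>n (z::real, a, b). z ^ n / fact n * rGamma (a * real n + b))"
    have "uniform_limit ({-R<..<R} \<times> ?K) (\<lambda>N p. \<Sum>n<N. t n p) (\<lambda>p. \<Sum>n. t n p) sequentially"
    proof (rule Weierstrass_m_test_ev[OF _ summable_wright_majorant[OF that]])
      show "\<forall>\<^sub>F n in sequentially. \<forall>p\<in>{-R<..<R} \<times> ?K. norm (t n p) \<le> wright_majorant R n"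
        using eventually_gt_at_top[of 0]
      proof eventually_elim
        case (elim n)
        then show ?case
          unfolding t_def using wright_term_le_majorant[of n _ R] by auto
      qed
    qed
    moreover have "continuous_on A (\<lambda>p. \<Sum>n<N. t n p)" for N A
      unfolding t_def split_beta
      by (intro continuous_intros continuous_on_compose2[OF continuous_on_rGamma[of UNIV]]) auto
    ultimately have "continuous_on ({-R<..<R} \<times> ?K) (\<lambda>p. \<Sum>n. t n p)"
      by (intro uniform_limit_theorem[where F = sequentially]) auto
    then show ?thesis
      by (simp add: t_def wright_def split_beta)
  qed
  show ?thesis
    unfolding continuous_on_eq_continuous_within
  proof
    fix p :: "real \<times> real \<times> real" assume p: "p \<in> UNIV \<times> ?K"
    define R where "R = \<bar>fst p\<bar> + 1"
    have pR: "p \<in> {-R<..<R} \<times> ?K"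
      using p by (auto simp: R_def)
    have "at p within UNIV \<times> ?K = at p within {-R<..<R} \<times> ?K"
      by (rule at_within_nhd[where S = "{-R<..<R} \<times> UNIV"]) (use pR in \<open>auto intro!: open_Times\<close>)
    moreover have "continuous (at p within {-R<..<R} \<times> ?K) ?f"
      using loc[of R] pR by (auto simp: R_def continuous_on_eq_continuous_within)
    ultimately show "continuous (at p within UNIV \<times> ?K) ?f"
      by simp
  qed
qed

lemma tendsto_wright:
  fixes f a b :: "'b \<Rightarrow> real"
  assumes "(f \<longlongrightarrow> z) F" "(a \<longlongrightarrow> a0) F" "(b \<longlongrightarrow> b0) F"
    and "\<forall>\<^sub>F x in F. a x \<in> {-1/2..-1/4}" "\<forall>\<^sub>F x in F. b x \<in> {1/2..1}"
    and "a0 \<in> {-1/2..-1/4}" "b0 \<in> {1/2..1}"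
  shows "((\<lambda>x. wright (f x) (a x) (b x)) \<longlongrightarrow> wright z a0 b0) F"
proof -
  have "((\<lambda>x. (f x, a x, b x)) \<longlongrightarrow> (z, a0, b0)) F"
    using assms by (intro tendsto_intros)
  from continuous_on_tendsto_compose[OF continuous_on_wright this]
  show ?thesis
    using assms eventually_conj[OF assms(4,5)] by (auto elim: eventually_mono)
qed

lemma continuous_on_wright_fst:
  fixes f :: "real \<Rightarrow> real"
  assumes "continuous_on A f" "a \<in> {-1/2..-1/4}" "b \<in> {1/2..1}"
  shows "continuous_on A (\<lambda>z. wright (f z) a b)"
proof -
  have "continuous_on A (\<lambda>z. (\<lambda>(z, a, b). wright z a b) (f z, a, b))"
    by (rule continuous_on_compose2[OF continuous_on_wright])
      (use assms in \<open>auto intro!: continuous_intros\<close>)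
  then show ?thesis by simp
qed

lemma continuous_on_mainardi:
  fixes A :: "real set"
  assumes "\<nu> \<in> {1/4..1/2}"
  shows "continuous_on A (mainardi \<nu>)"
  unfolding mainardi_def using assms
  by (intro continuous_on_wright_fst continuous_intros) auto

section \<open>The Mainardi function at 1/2\<close>

lemma rGamma_half_minus_nat:
  "rGamma (1/2 - real m) = (-1) ^ m * fact (2 * m) / (4 ^ m * fact m * sqrt pi)"
proof (induction m)
  case 0
  show ?case
    by (simp add: rGamma_inverse_Gamma Gamma_one_half_real field_simps)
next
  case (Suc m)
  have "rGamma (1/2 - real (Suc m)) = (1/2 - real (Suc m)) * rGamma (1/2 - real m)"
    using rGamma_plus1[of "1/2 - real (Suc m)"] by (simp add: algebra_simps)
  also have "\<dots> = (-1) ^ Suc m * fact (2 * Suc m) / (4 ^ Suc m * fact (Suc m) * sqrt pi)"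
    unfolding Suc.IH by (simp add: divide_simps) (simp add: algebra_simps)
  finally show ?case .
qed

text \<open>The odd terms sit at poles of \<open>\<Gamma>\<close> and vanish; the even ones form the series of
  \<open>exp (- x\<^sup>2 / 4)\<close>.\<close>

lemma mainardi_half:
  fixes x :: real
  shows "mainardi (1/2) x = exp (- (x\<^sup>2 / 4)) / sqrt pi"
proof -
  define f where "f = (\<lambda>n. (- x) ^ n / fact n * rGamma (- (1/2) * real n + 1/2))"
  have odd_zero: "f n = 0" if "n \<notin> range (\<lambda>m. 2 * m)" for n
  proof -
    have "odd n" using that by (auto elim!: evenE)
    then obtain m where "n = 2 * m + 1" by (auto elim!: oddE)
    then have "- (1/2) * real n + 1/2 = - real m" by (simp add: field_simps)
    then show ?thesis unfolding f_def by simp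
  qed
  have "f (2 * m) = (1 / sqrt pi) * ((- (x\<^sup>2 / 4)) ^ m / fact m)" for m
  proof -
    have e: "- (1/2) * real (2 * m) + 1/2 = 1/2 - real m" by simp
    have "(- (x\<^sup>2 / 4)) ^ m = (-1) ^ m * (- x) ^ (2 * m) / 4 ^ m"
      by (simp add: power_mult power_minus[of "x\<^sup>2 / 4"] power_divide)
    then show ?thesis
      unfolding f_def e rGamma_half_minus_nat by (simp add: field_simps)
  qed
  moreover have "(\<lambda>m. y ^ m / fact m) sums exp y" for y :: real
    using exp_converges[of y] by (simp add: divide_inverse mult.commute)
  ultimately have "(\<lambda>m. f (2 * m)) sums ((1 / sqrt pi) * exp (- (x\<^sup>2 / 4)))"
    by (simp only: sums_mult)
  then have "f sums ((1 / sqrt pi) * exp (- (x\<^sup>2 / 4)))"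
    using sums_mono_reindex[of "\<lambda>m. 2 * m" f] odd_zero by (auto simp: strict_mono_def)
  then show ?thesis
    by (simp add: mainardi_def wright_def f_def sums_iff)
qed

text \<open>Division by \<open>M\<^sub>\<nu>\<close> is harmless near the limit: positivity of the Gaussian persists in a
  one-sided neighbourhood of \<open>(z0, 1/2)\<close>, by joint continuity, and the intermediate value argument
  takes place inside it.\<close>

lemma mainardi_pos_near_half:
  fixes z0 :: real
  obtains r where "r > 0"
    and "\<And>\<nu> z. \<nu> \<in> {1/4..1/2} \<Longrightarrow> 1/2 - r < \<nu> \<Longrightarrow> \<bar>z - z0\<bar> < r \<Longrightarrow> mainardi \<nu> z > 0"
proof -
  let ?M = "\<lambda>(z::real, \<nu>). mainardi \<nu> z"
  have "continuous_on (UNIV \<times> {1/4..1/2})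
      (\<lambda>p. (\<lambda>(z, a, b). wright z a b) (- fst p, - snd p, 1 - snd p) :: real)"
    by (rule continuous_on_compose2[OF continuous_on_wright]) (auto intro!: continuous_intros)
  then have "continuous_on (UNIV \<times> {1/4..1/2}) ?M"
    by (simp add: mainardi_def split_beta)
  moreover have "mainardi (1/2) z0 > 0"
    by (simp add: mainardi_half)
  moreover have "(z0, 1/2) \<in> UNIV \<times> {1/4..1/2::real}"
    by simp
  ultimately obtain r where "r > 0" and r_dist:
    "\<forall>p\<in>UNIV \<times> {1/4..1/2}. dist p (z0, 1/2) < r \<longrightarrow>
      dist (?M p) (?M (z0, 1/2)) < mainardi (1/2) z0"
    unfolding continuous_on_iff by blast
  have "mainardi \<nu> z > 0"
    if "\<nu> \<in> {1/4..1/2}" "1/2 - r/2 < \<nu>" "\<bar>z - z0\<bar> < r/2" for \<nu> z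
  proof -
    have "dist (z, \<nu>) (z0, 1/2) \<le> \<bar>z - z0\<bar> + \<bar>\<nu> - 1/2\<bar>"
      unfolding dist_prod_def dist_real_def using sqrt_sum_squares_le_sum_abs by simp
    also have "\<dots> < r" using that by auto
    finally have "dist (mainardi \<nu> z) (mainardi (1/2) z0) < mainardi (1/2) z0"
      using r_dist that(1) by auto
    then show ?thesis
      by (auto simp: dist_real_def)
  qed
  with \<open>r > 0\<close> show thesis
    by (intro that[of "r/2"]) auto
qed

section \<open>The error function as a limit case\<close>

lemma has_real_derivative_erf:
  "(erf has_real_derivative 2 / sqrt pi * exp (- (x\<^sup>2))) (at x)"
proof -
  define R where "R = \<bar>x\<bar> + 1"
  have x: "x \<in> {-R<..<R}" by (auto simp: R_def)
  have "((\<lambda>u. LBINT y=ereal 0..u. exp (- (y\<^sup>2))) has_vector_derivative exp (- (x\<^sup>2)))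
      (at x within {-R..R})"
    by (rule interval_integral_FTC2) (auto simp: R_def intro!: continuous_intros)
  then have "((\<lambda>u. LBINT y=0..u. exp (- (y\<^sup>2))) has_real_derivative exp (- (x\<^sup>2))) (at x)"
    using x at_within_Icc_at[of "-R" x R]
    by (simp add: has_real_derivative_iff_has_vector_derivative zero_ereal_def)
  from DERIV_cmult[OF this, of "2 / sqrt pi"] show ?thesis
    unfolding erf_def[abs_def] by simp
qed

lemma erf_0 [simp]: "erf 0 = 0"
  by (simp add: erf_def zero_ereal_def)

lemma erf_strict_mono: "x < y \<Longrightarrow> erf x < erf y"
  by (rule DERIV_pos_imp_increasing) (auto intro!: exI has_real_derivative_erf)

lemma continuous_on_erf: "continuous_on A erf"
  using has_real_derivative_erf
  by (meson DERIV_continuous continuous_at_imp_continuous_on)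

text \<open>Termwise differentiation turns \<open>W(z, a, b)\<close> into \<open>W(z, a, a + b)\<close>, so \<open>W(-x, -1/2, 1)\<close> has
  derivative \<open>- M\<^sub>1\<^sub>/\<^sub>2(x)\<close>, the negative of the derivative of \<open>erf (x / 2)\<close>; the constant comes
  from \<open>x = 0\<close>.\<close>

lemma wright_half: "wright (- x) (- (1/2)) 1 = 1 - erf (x / 2)"
proof -
  define c where "c = (\<lambda>n. 1 / fact n * rGamma (- (1/2) * real n + 1 :: real))"
  have W: "wright z (- (1/2)) 1 = (\<Sum>n. c n * z ^ n)" for z
    by (simp add: wright_def c_def mult.commute)
  have "diffs c n * z ^ n = z ^ n / fact n * rGamma (- (1/2) * real n + 1/2)" for n z
  proof -
    have "- (1/2) * real (Suc n) + 1 = - (1/2) * real n + 1/2"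
      by (simp add: field_simps)
    then have "diffs c n = real (Suc n) * (1 / fact (Suc n) * rGamma (- (1/2) * real n + 1/2))"
      unfolding diffs_def c_def by metis
    also have "\<dots> = 1 / fact n * rGamma (- (1/2) * real n + 1/2)"
      by (simp del: of_nat_Suc)
    finally show ?thesis by simp
  qed
  then have diffs: "(\<Sum>n. diffs c n * (- z) ^ n) = mainardi (1/2) z" for z
    by (simp add: mainardi_def wright_def)
  have "summable (\<lambda>n. c n * z ^ n)" for z
    using summable_wright[of "-1/2" 1 z] by (simp add: c_def mult.commute)
  from termdiffs_strong_converges_everywhere[OF this]
  have "((\<lambda>z. wright z (- (1/2)) 1) has_real_derivative mainardi (1/2) z) (at (- z))" for z
    unfolding W diffs[symmetric] .
  from DERIV_chain2[OF this DERIV_minus[OF DERIV_ident]]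
  have dW: "((\<lambda>z. wright (- z) (- (1/2)) 1) has_real_derivative - mainardi (1/2) z) (at z)" for z
    by simp
  have "((\<lambda>z. erf (z / 2)) has_real_derivative 2 / sqrt pi * exp (- ((z / 2)\<^sup>2)) * (1/2)) (at z)" for z
    by (rule DERIV_chain2[OF has_real_derivative_erf]) (auto intro!: derivative_eq_intros)
  from DERIV_add[OF dW this]
  have "((\<lambda>z. wright (- z) (- (1/2)) 1 + erf (z / 2)) has_real_derivative 0) (at z)" for z
    by (simp add: mainardi_half power_divide)
  from DERIV_isconst_all[OF allI[OF this], of x 0]
  have "wright (- x) (- (1/2)) 1 + erf (x / 2) = wright 0 (- (1/2)) 1"
    by simp
  also have "\<dots> = 1"
    unfolding W powser_zero by (simp add: c_def rGamma_inverse_Gamma)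
  finally show ?thesis by simp
qed

section \<open>The limit equation and convergence of the roots\<close>

lemma Gamma_three_halves: "Gamma (3/2 :: real) = sqrt pi / 2"
  using rGamma_plus1[of "1/2 :: real"]
  by (simp add: rGamma_inverse_Gamma Gamma_one_half_real field_simps)

lemma stefan_lhs_strict_mono:
  assumes "0 \<le> x" "x < y"
  shows "x / 2 * erf (x / 2) * exp (x\<^sup>2 / 4) < y / 2 * erf (y / 2) * exp (y\<^sup>2 / 4)"
proof -
  have e: "0 \<le> erf (x / 2)" "erf (x / 2) < erf (y / 2)"
    using erf_strict_mono[of 0 "x / 2"] erf_strict_mono[of "x / 2" "y / 2"] assms
    by (cases "x = 0"; force)+
  have "x / 2 * erf (x / 2) < y / 2 * erf (y / 2)"
    using e assms by (intro mult_strict_mono) auto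
  moreover have "exp (x\<^sup>2 / 4) \<le> exp (y\<^sup>2 / 4)"
    using assms by (simp add: power_mono)
  ultimately show ?thesis
    by (rule mult_less_le_imp_less) (use e assms in auto)
qed

lemma unique_pos_solution_stefan_eq:
  assumes "k > 0" "l > 0" "C < B"
  shows "\<exists>\<xi>. unique_pos_solution (stefan_eq l k B C) \<xi>"
proof -
  define K where "K = k / l\<^sup>2 * ((B - C) / sqrt pi)"
  define h where "h = (\<lambda>z. z / 2 * erf (z / 2) * exp (z\<^sup>2 / 4))"
  have K: "K > 0" using assms by (simp add: K_def)
  have e: "erf (1/2) > 0" using erf_strict_mono[of 0 "1/2"] by simp
  \<comment> \<open>Beyond \<open>1\<close> the factor \<open>erf\<close> is at least \<open>erf (1/2)\<close>, so the linear factor alone reaches \<open>K\<close>.\<close>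
  define b where "b = max 1 (2 * K / erf (1/2))"
  have b: "b \<ge> 1" "b / 2 * erf (1/2) \<ge> K"
    using e by (auto simp: b_def field_simps max_def)
  have "erf (1/2) \<le> erf (b / 2)"
    using b erf_strict_mono[of "1/2" "b / 2"] by (cases "b = 1") auto
  then have "K \<le> b / 2 * erf (b / 2) * 1"
    using b(1) by (intro order_trans[OF b(2)]) (simp add: mult_left_mono)
  also have "\<dots> \<le> h b"
    unfolding h_def using e b \<open>erf (1/2) \<le> erf (b / 2)\<close> by (intro mult_left_mono) auto
  finally have "K \<le> h b" .
  moreover have "continuous_on {0..b} h"
    unfolding h_def by (intro continuous_intros continuous_on_compose2[OF continuous_on_erf[of UNIV]]) auto
  ultimately obtain z where z: "0 \<le> z" "h z = K"
    using IVT'[of h 0 K b] K b by (auto simp: h_def)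
  have "z > 0" using z K by (cases "z = 0") (auto simp: h_def)
  moreover have "w = z" if "w > 0" "h w = K" for w
    using stefan_lhs_strict_mono[of w z] stefan_lhs_strict_mono[of z w] that z
    by (fastforce simp: h_def)
  ultimately show ?thesis
    using z unfolding unique_pos_solution_def stefan_eq_def h_def K_def by blast
qed

text \<open>Pointwise convergence \<open>g a \<rightarrow> h\<close> fixes the signs of \<open>g a\<close> at the two end
  points of any small interval around \<open>z0\<close>, which traps a root, and uniqueness says which root
  it is.\<close>

lemma tendsto_unique_root:
  fixes g :: "'b \<Rightarrow> real \<Rightarrow> real" and h :: "real \<Rightarrow> real"
  assumes d: "d > 0"
    and cont: "\<forall>\<^sub>F a in F. continuous_on {z0 - d..z0 + d} (g a)"
    and lim: "\<And>z. z \<in> {z0 - d..z0 + d} \<Longrightarrow> ((\<lambda>a. g a z) \<longlongrightarrow> h z) F"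
    and neg: "\<And>z. z \<in> {z0 - d..<z0} \<Longrightarrow> h z < 0"
    and pos: "\<And>z. z \<in> {z0<..z0 + d} \<Longrightarrow> h z > 0"
    and uniq: "\<forall>\<^sub>F a in F. \<forall>z\<in>{z0 - d..z0 + d}. g a z = 0 \<longrightarrow> z = \<xi> a"
  shows "(\<xi> \<longlongrightarrow> z0) F"
proof (rule tendstoI)
  fix \<epsilon> :: real assume "\<epsilon> > 0"
  define e where "e = min d (\<epsilon> / 2)"
  have e: "0 < e" "e \<le> d" "e < \<epsilon>"
    using d \<open>\<epsilon> > 0\<close> by (auto simp: e_def)
  have "\<forall>\<^sub>F a in F. g a (z0 - e) < 0"
    using e by (intro order_tendstoD(2)[OF lim neg]) auto
  moreover have "\<forall>\<^sub>F a in F. g a (z0 + e) > 0"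
    using e by (intro order_tendstoD(1)[OF lim pos]) auto
  ultimately show "\<forall>\<^sub>F a in F. dist (\<xi> a) z0 < \<epsilon>"
    using cont uniq
  proof eventually_elim
    case (elim a)
    have "continuous_on {z0 - e..z0 + e} (g a)"
      using elim(3) by (rule continuous_on_subset) (use e in auto)
    then obtain z where z: "z0 - e \<le> z" "z \<le> z0 + e" "g a z = 0"
      using IVT'[of "g a" "z0 - e" 0 "z0 + e"] elim e by auto
    then have "z = \<xi> a"
      using elim(4) e by auto
    then show ?case
      using z e by (auto simp: dist_real_def)
  qed
qed

theorem mainTheorem4:
  fixes l k B C :: real and \<xi> :: "real \<Rightarrow> real"
  assumes "l > 0" and "k > 0" and "B > 0" and "C < B"
    and "\<And>\<alpha>. 0 < \<alpha> \<Longrightarrow> \<alpha> < 1 \<Longrightarrow> unique_pos_solution (frac_stefan_eq l k B C \<alpha>) (\<xi> \<alpha>)"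
  shows "\<exists>\<xi>1. unique_pos_solution (stefan_eq l k B C) \<xi>1 \<and>
    (\<forall>x\<ge>0. \<forall>t>0.
      ((\<lambda>\<alpha>. frac_stefan_u l B C \<alpha> (\<xi> \<alpha>) x t)
         \<longlongrightarrow> B + (C - B) / erf (\<xi>1 / 2) * erf (x / (2 * l * sqrt t))) (at_left 1) \<and>
      ((\<lambda>\<alpha>. frac_stefan_s l \<alpha> (\<xi> \<alpha>) t) \<longlongrightarrow> l * \<xi>1 * sqrt t) (at_left 1))"
proof -
  obtain z1 where z1: "unique_pos_solution (stefan_eq l k B C) z1"
    using unique_pos_solution_stefan_eq assms by blast
  then have z1_pos: "z1 > 0" and z1_eq: "stefan_eq l k B C z1"
    by (auto simp: unique_pos_solution_def)
  have ev: "\<forall>\<^sub>F \<alpha> in at_left (1::real). 1/2 < \<alpha> \<and> \<alpha> < 1"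
    using eventually_at_left_real[of "1/2" 1] by simp
  have evc: "\<forall>\<^sub>F \<alpha> in at_left 1. \<alpha> > c" if "c < 1" for c :: real
    using eventually_at_left_real[OF that] by (auto elim: eventually_mono)
  have id: "((\<lambda>\<alpha>. \<alpha>) \<longlongrightarrow> (1::real)) (at_left 1)"
    by (rule tendsto_ident_at)
  have limW: "((\<lambda>\<alpha>. wright (- f \<alpha>) (- (\<alpha> / 2)) 1) \<longlongrightarrow> 1 - erf (z / 2)) (at_left 1)"
    if "(f \<longlongrightarrow> z) (at_left 1)" for f z
    unfolding wright_half[symmetric]
    using that id ev by (intro tendsto_wright tendsto_intros) (auto elim!: eventually_mono)
  have limM: "((\<lambda>\<alpha>. mainardi (\<alpha> / 2) (f \<alpha>)) \<longlongrightarrow> mainardi (1/2) z) (at_left 1)"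
    if "(f \<longlongrightarrow> z) (at_left 1)" for f and z :: real
    unfolding mainardi_def
    using that id ev by (intro tendsto_wright tendsto_intros) (auto elim!: eventually_mono)

  define g where "g = (\<lambda>\<alpha> z. z * (1 - wright (- z) (- (\<alpha> / 2)) 1) * (1 / mainardi (\<alpha> / 2) z)
     - k / l\<^sup>2 * (Gamma (1 - \<alpha> / 2) / Gamma (1 + \<alpha> / 2)) * (B - C))"
  have g_iff: "g \<alpha> z = 0 \<longleftrightarrow> frac_stefan_eq l k B C \<alpha> z" for \<alpha> z
    by (simp add: g_def frac_stefan_eq_def)
  \<comment> \<open>The limit of \<open>g \<alpha>\<close>; the factor \<open>2 \<surd>\<pi>\<close> comes from \<open>1 / M\<^sub>1\<^sub>/\<^sub>2\<close> and from \<open>\<Gamma>(1/2) / \<Gamma>(3/2) = 2\<close>.\<close>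
  define h where "h = (\<lambda>z. 2 * sqrt pi * (z / 2 * erf (z / 2) * exp (z\<^sup>2 / 4)
     - k / l\<^sup>2 * ((B - C) / sqrt pi)))"
  obtain r where r: "r > 0"
    and M_pos: "\<And>\<nu> z. \<nu> \<in> {1/4..1/2} \<Longrightarrow> 1/2 - r < \<nu> \<Longrightarrow> \<bar>z - z1\<bar> < r \<Longrightarrow> mainardi \<nu> z > 0"
    using mainardi_pos_near_half[of z1] by blast
  have r2: "1 - r < 1"
    using r by simp
  \<comment> \<open>The interval of radius \<open>d\<close> must keep \<open>M\<close> positive, and must consist of positive numbers for the
    uniqueness of \<open>\<xi> \<alpha>\<close> to apply to it.\<close>
  define d where "d = min r z1 / 2"
  have d: "d > 0" "d < r" "d < z1"
    using r z1_pos by (auto simp: d_def)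
  have \<xi>_lim: "(\<xi> \<longlongrightarrow> z1) (at_left 1)"
  proof (rule tendsto_unique_root[where d = d and g = g and h = h])
    show "\<forall>\<^sub>F \<alpha> in at_left 1. continuous_on {z1 - d..z1 + d} (g \<alpha>)"
      using ev evc[OF r2]
    proof eventually_elim
      case (elim \<alpha>)
      then have "mainardi (\<alpha> / 2) z \<noteq> 0" if "z \<in> {z1 - d..z1 + d}" for z
      proof -
        have "\<bar>z - z1\<bar> < r"
          using that d(2) unfolding atLeastAtMost_iff by arith
        then show ?thesis
          using M_pos[of "\<alpha> / 2" z] elim by simp
      qed
      then show ?case
        unfolding g_def using elim
        by (intro continuous_intros continuous_on_mainardi continuous_on_wright_fst) auto
    qed
    show "((\<lambda>\<alpha>. g \<alpha> z) \<longlongrightarrow> h z) (at_left 1)" for z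
    proof -
      have notin: "x \<notin> \<int>\<^sub>\<le>\<^sub>0" if "x > 0" for x :: real
        using Gamma_real_pos[OF that] Gamma_eq_zero_iff[of x] by auto
      have "((\<lambda>\<alpha>. g \<alpha> z) \<longlongrightarrow> z * (1 - (1 - erf (z / 2))) * (1 / mainardi (1/2) z)
          - k / l\<^sup>2 * (Gamma (1 - 1/2) / Gamma (1 + 1/2)) * (B - C)) (at_left 1)"
        unfolding g_def
        by (intro tendsto_intros limW limM id)
          (auto simp: mainardi_half Gamma_three_halves notin)
      also have "z * (1 - (1 - erf (z / 2))) * (1 / mainardi (1/2) z)
          - k / l\<^sup>2 * (Gamma (1 - 1/2) / Gamma (1 + 1/2)) * (B - C) = h z"
        using assms(1)
        by (simp add: Gamma_three_halves Gamma_one_half_real h_def mainardi_half exp_minus field_simps)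
      finally show ?thesis .
    qed
    show "h z < 0" if "z \<in> {z1 - d..<z1}" for z
      using stefan_lhs_strict_mono[of z z1] that d z1_eq
      by (auto simp: h_def stefan_eq_def mult_less_0_iff)
    show "h z > 0" if "z \<in> {z1<..z1 + d}" for z
      using stefan_lhs_strict_mono[of z1 z] that z1_pos z1_eq
      by (auto simp: h_def stefan_eq_def zero_less_mult_iff)
    show "\<forall>\<^sub>F \<alpha> in at_left 1. \<forall>z\<in>{z1 - d..z1 + d}. g \<alpha> z = 0 \<longrightarrow> z = \<xi> \<alpha>"
      using ev
    proof eventually_elim
      case (elim \<alpha>)
      then show ?case
        using assms(5)[of \<alpha>] d unfolding g_iff unique_pos_solution_def by auto
    qed
  qed (use d in auto)

  have erf_pos: "erf (z1 / 2) > 0"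
    using erf_strict_mono[of 0 "z1 / 2"] z1_pos by simp
  have powr_lim: "((\<lambda>\<alpha>. t powr (\<alpha> / 2)) \<longlongrightarrow> sqrt t) (at_left 1)" if "t > 0" for t :: real
    using that by (auto simp: powr_half_sqrt[symmetric] intro!: tendsto_eq_intros id)
  show ?thesis
  proof (intro exI[of _ z1] conjI z1 allI impI)
    fix x t :: real assume xt: "x \<ge> 0" "t > 0"
    have "((\<lambda>\<alpha>. x / (l * t powr (\<alpha> / 2))) \<longlongrightarrow> x / (l * sqrt t)) (at_left 1)"
      using assms(1) xt by (intro tendsto_intros powr_lim) auto
    from limW[OF this] limW[OF \<xi>_lim]
    have "((\<lambda>\<alpha>. frac_stefan_u l B C \<alpha> (\<xi> \<alpha>) x t)
         \<longlongrightarrow> B + (C - B) / (1 - (1 - erf (z1 / 2))) * (1 - (1 - erf (x / (l * sqrt t) / 2)))) (at_left 1)"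
      unfolding frac_stefan_u_def using erf_pos by (intro tendsto_intros) auto
    then show "((\<lambda>\<alpha>. frac_stefan_u l B C \<alpha> (\<xi> \<alpha>) x t)
         \<longlongrightarrow> B + (C - B) / erf (z1 / 2) * erf (x / (2 * l * sqrt t))) (at_left 1)"
      by (simp add: mult_ac)
    show "((\<lambda>\<alpha>. frac_stefan_s l \<alpha> (\<xi> \<alpha>) t) \<longlongrightarrow> l * z1 * sqrt t) (at_left 1)"
      unfolding frac_stefan_s_def using xt by (intro tendsto_intros powr_lim \<xi>_lim) auto
  qed
qed

end
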